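(* Consider the TV-ARMA($p,q$) equation with deterministic coefficients $y_t=\varphi(t)+\sum_{m=1}^{p}\phi_m(t)y_{t-m}+\varepsilon_t+\sum_{l=1}^{q}\theta_l(t)\varepsilon_{t-l}$, $t\in\mathbb{Z}$. Suppose $\sum_{r=-\infty}^{t}|\xi(t,r)|<\infty$ for all $t$, and that $\varphi(t)$ and $\theta_l(t)$ ($1\le l\le q$) are bounded functions of $t$. Then there exists a uniquely determined asymptotically stable stochastic process in $L_2$ which solves the equation, and it coincides almost surely with $$y_t=\sum_{r=-\infty}^{t}\xi(t,r)\varphi(r)+\sum_{r=-\infty}^{t}\xi_q(t,r)\varepsilon_r .$$
   Context: Let $p,q\ge 1$ be integers and $L_2=L_2(\Omega,\mathcal F,P)$. The coefficients $\varphi(t),\phi_m(t),\theta_l(t)$ are deterministic real-valued functions of $t\in\mathbb{Z}$. The errors satisfy $\mathbb{E}(\varepsilon_t)=0$, $\mathbb{E}(\varepsilon_t\varepsilon_s)=0$ for $s\ne t$, $\mathbb{E}(\varepsilon_t\mid y_s,s<t)=0$, $\mathbb{E}(\varepsilon_t^2)=\sigma^2(t)$ with $0<\sigma^2(t)\le M<\infty$ for all $t$ and some $M$. Infinite sums of random variables are understood as limits in $L_2$. Principal determinant: for integers $s<t$, $\xi(t,s)=\det(\mathbf{\Phi}_{t,s})$, where $\mathbf{\Phi}_{t,s}$ is the $(t-s)\times(t-s)$ matrix whose $(i,j)$ entry is $\phi_{i-j+1}(s+i)$ if $0\le i-j\le p-1$, $-1$ if $j=i+1$, and $0$ otherwise.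 Moreover $\xi(t,t)=1$ and $\xi(t,s)=0$ for $t<s$. Also $\xi_q(t,r)=\xi(t,r)+\sum_{l=1}^{q}\xi(t,r+l)\theta_l(r+l)$, and for $1\le m\le p$, $\xi^{(m)}(t,s)=\sum_{r=1}^{p+1-m}\phi_{m-1+r}(s+r)\,\xi(t,s+r)$. A process $y_t$ solving the equation is asymptotically stable (in $L_2$) if for each $t$, $\sum_{m=1}^{p}\xi^{(m)}(t,s)\,y_{s+1-m}\to 0$ in $L_2$ as $s\to-\infty$. *)

theory Defs
  imports "HOL-Probability.Probability" "Jordan_Normal_Form.Determinant"
begin

text \<open>
  Coefficients are functions on the integers; families with a lag index are written
  \<open>\<phi> m t\<close> (used for \<open>1 \<le> m \<le> p\<close>) and \<open>\<theta> l t\<close> (used for \<open>1 \<le> l \<le> q\<close>).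
  The intercept, customarily also a letter phi, is written \<open>\<mu> t\<close>.
  A stochastic process is a function of type \<open>int \<Rightarrow> 'a \<Rightarrow> real\<close>.
\<close>

text \<open>
  Matrices are indexed from 0, so the entry at \<open>(i, j)\<close> here is the usual entry at
  \<open>(i + 1, j + 1)\<close>; this shifts the time argument of the coefficient by one and leaves
  \<open>i - j\<close> unchanged.
\<close>

definition principal_matrix :: "nat \<Rightarrow> (nat \<Rightarrow> int \<Rightarrow> real) \<Rightarrow> int \<Rightarrow> int \<Rightarrow> real mat" where
  "principal_matrix p \<phi> t s =
     Matrix.mat (nat (t - s)) (nat (t - s))
       (\<lambda>(i, j). if j \<le> i \<and> i - j \<le> p - 1 then \<phi> (i - j + 1) (s + int (i + 1))
                 else if j = i + 1 then - 1
                 else 0)"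

definition principal_det :: "nat \<Rightarrow> (nat \<Rightarrow> int \<Rightarrow> real) \<Rightarrow> int \<Rightarrow> int \<Rightarrow> real" where
  "principal_det p \<phi> t s =
     (if s < t then Determinant.det (principal_matrix p \<phi> t s)
      else if s = t then 1 else 0)"

definition principal_det_ma ::
    "nat \<Rightarrow> nat \<Rightarrow> (nat \<Rightarrow> int \<Rightarrow> real) \<Rightarrow> (nat \<Rightarrow> int \<Rightarrow> real) \<Rightarrow> int \<Rightarrow> int \<Rightarrow> real" where
  "principal_det_ma p q \<phi> \<theta> t r =
     principal_det p \<phi> t r
     + (\<Sum>l = 1..q. principal_det p \<phi> t (r + int l) * \<theta> l (r + int l))"

definition fundamental_sol ::
    "nat \<Rightarrow> (nat \<Rightarrow> int \<Rightarrow> real) \<Rightarrow> nat \<Rightarrow> int \<Rightarrow> int \<Rightarrow> real" where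
  "fundamental_sol p \<phi> m t s =
     (\<Sum>r = 1..p + 1 - m. \<phi> (m - 1 + r) (s + int r) * principal_det p \<phi> t (s + int r))"

definition L2 :: "'a measure \<Rightarrow> ('a \<Rightarrow> real) set" where
  "L2 M = {f \<in> borel_measurable M. integrable M (\<lambda>x. (f x)\<^sup>2)}"

text \<open>
  Membership in \<open>L2 M\<close> is part of the notion of convergence, since the integral of a
  non-integrable function is 0 by convention.
\<close>

definition tendsto_L2 ::
    "'a measure \<Rightarrow> ('i \<Rightarrow> 'a \<Rightarrow> real) \<Rightarrow> ('a \<Rightarrow> real) \<Rightarrow> 'i filter \<Rightarrow> bool" where
  "tendsto_L2 M X Y F \<longleftrightarrow>
     (\<forall>i. X i \<in> L2 M) \<and> Y \<in> L2 M \<and>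
     ((\<lambda>i. \<integral>x. (X i x - Y x)\<^sup>2 \<partial>M) \<longlongrightarrow> 0) F"

text \<open>\<open>S\<close> is the sum of \<open>X r\<close> over all \<open>r \<le> t\<close>, as a limit in \<open>L2\<close>.\<close>

definition L2_sums_upto ::
    "'a measure \<Rightarrow> (int \<Rightarrow> 'a \<Rightarrow> real) \<Rightarrow> int \<Rightarrow> ('a \<Rightarrow> real) \<Rightarrow> bool" where
  "L2_sums_upto M X t S \<longleftrightarrow> tendsto_L2 M (\<lambda>s x. \<Sum>r = s..t. X r x) S at_bot"

text \<open>The \<open>\<sigma>\<close>-algebra generated by \<open>y s\<close>, \<open>s < t\<close>.\<close>

definition past_algebra :: "'a measure \<Rightarrow> (int \<Rightarrow> 'a \<Rightarrow> real) \<Rightarrow> int \<Rightarrow> 'a measure" where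
  "past_algebra M y t =
     sigma (space M) (\<Union>s\<in>{..<t}. {y s -` A \<inter> space M | A. A \<in> sets borel})"

definition solves_tvarma ::
    "'a measure \<Rightarrow> nat \<Rightarrow> nat \<Rightarrow> (int \<Rightarrow> real) \<Rightarrow> (nat \<Rightarrow> int \<Rightarrow> real) \<Rightarrow> (nat \<Rightarrow> int \<Rightarrow> real)
      \<Rightarrow> (int \<Rightarrow> 'a \<Rightarrow> real) \<Rightarrow> (int \<Rightarrow> 'a \<Rightarrow> real) \<Rightarrow> bool" where
  "solves_tvarma M p q \<mu> \<phi> \<theta> \<epsilon> y \<longleftrightarrow>
     (\<forall>t. AE x in M.
        y t x = \<mu> t + (\<Sum>m = 1..p. \<phi> m t * y (t - int m) x)
                + \<epsilon> t x + (\<Sum>l = 1..q. \<theta> l t * \<epsilon> (t - int l) x))"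

definition asymptotically_stable ::
    "'a measure \<Rightarrow> nat \<Rightarrow> (nat \<Rightarrow> int \<Rightarrow> real) \<Rightarrow> (int \<Rightarrow> 'a \<Rightarrow> real) \<Rightarrow> bool" where
  "asymptotically_stable M p \<phi> y \<longleftrightarrow>
     (\<forall>t. tendsto_L2 M
        (\<lambda>s x. \<Sum>m = 1..p. fundamental_sol p \<phi> m t s * y (s + 1 - int m) x) (\<lambda>x. 0) at_bot)"

definition stable_L2_solution ::
    "'a measure \<Rightarrow> nat \<Rightarrow> nat \<Rightarrow> (int \<Rightarrow> real) \<Rightarrow> (nat \<Rightarrow> int \<Rightarrow> real) \<Rightarrow> (nat \<Rightarrow> int \<Rightarrow> real)
      \<Rightarrow> (int \<Rightarrow> 'a \<Rightarrow> real) \<Rightarrow> (int \<Rightarrow> 'a \<Rightarrow> real) \<Rightarrow> bool" where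
  "stable_L2_solution M p q \<mu> \<phi> \<theta> \<epsilon> y \<longleftrightarrow>
     (\<forall>t. y t \<in> L2 M) \<and> solves_tvarma M p q \<mu> \<phi> \<theta> \<epsilon> y \<and> asymptotically_stable M p \<phi> y"

end

theory Submission
  imports Defs
begin

text \<open>
  Write \<open>v t\<close> for the intercept plus the moving average part. Expanding the principal
  determinant along its first column yields a recursion in \<open>s\<close>, which shows that every solution is
  \<open>\<Sum>m. \<xi>\<^sup>m(t,s) y (s + 1 - m) + \<Sum>r = s + 1..t. \<xi>(t,r) v r\<close>. Hence asymptotic stability means
  precisely that \<open>y t\<close> is the \<open>L2\<close> limit of the second sum, which gives uniqueness. This limit
  exists because the \<open>v r\<close> are bounded in \<open>L2\<close> and \<open>\<xi>(t, \<cdot>)\<close> is absolutely summable, and it solves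
  the equation because \<open>\<xi>\<close> satisfies the homogeneous equation in \<open>t\<close>.
\<close>

section \<open>Principal determinants and difference equations\<close>

text \<open>The empty matrix has determinant 1, so the convention at \<open>s = t\<close> agrees
  with the determinant. The cofactor computation needs this when the last row is deleted.\<close>

lemma principal_det_eq_det:
  assumes "s \<le> t"
  shows "principal_det p \<phi> t s = Determinant.det (principal_matrix p \<phi> t s)"
proof (cases "s = t")
  case True
  then have "principal_matrix p \<phi> t s \<in> carrier_mat 0 0"
    by (simp add: principal_matrix_def)
  then show ?thesis
    using True by (simp add: principal_det_def)
qed (use assms in \<open>simp add: principal_det_def\<close>)

lemma principal_det_self [simp]: "principal_det p \<phi> t t = 1"
  by (simp add: principal_det_def)

lemma principal_det_eq_0 [simp]: "t < s \<Longrightarrow> principal_det p \<phi> t s = 0"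
  by (simp add: principal_det_def)

text \<open>
  Deleting row \<open>i\<close> and the first column leaves a block lower triangular matrix, whose
  upper left block is lower triangular with diagonal \<open>-1\<close>.
\<close>

lemma cofactor_principal_matrix:
  assumes "i < nat (t - s)"
  shows "cofactor (principal_matrix p \<phi> t s) i 0 = principal_det p \<phi> t (s + int i + 1)"
proof -
  define n where "n = nat (t - s)"
  define A where "A = principal_matrix p \<phi> t s"
  have A: "A \<in> carrier_mat n n"
    by (simp add: A_def principal_matrix_def n_def)
  have A_index: "A $$ (a, b) =
      (if b \<le> a \<and> a - b \<le> p - 1 then \<phi> (a - b + 1) (s + int (a + 1))
       else if b = a + 1 then - 1 else 0)" if "a < n" "b < n" for a b
    using that by (simp add: A_def principal_matrix_def n_def)
  define m where "m = n - Suc i"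
  define L where "L = Matrix.mat i i (\<lambda>(a, b). A $$ (a, Suc b))"
  define C where "C = Matrix.mat m i (\<lambda>(a, b). A $$ (Suc (a + i), Suc b))"
  define D where "D = principal_matrix p \<phi> t (s + int i + 1)"
  have n: "n = Suc (i + m)"
    using assms by (simp add: m_def n_def)
  have dim_D: "nat (t - (s + int i + 1)) = m"
    using assms by (simp add: m_def n_def)
  have D: "D \<in> carrier_mat m m"
    by (simp add: D_def principal_matrix_def dim_D)
  have L: "L \<in> carrier_mat i i" and C: "C \<in> carrier_mat m i"
    by (simp_all add: L_def C_def)
  have "mat_delete A i 0 = four_block_mat L (0\<^sub>m i m) C D"
  proof (rule eq_matI)
    fix a b
    assume "a < dim_row (four_block_mat L (0\<^sub>m i m) C D)"
      and "b < dim_col (four_block_mat L (0\<^sub>m i m) C D)"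
    then have a: "a < i + m" and b: "b < i + m"
      using L D by auto
    have "mat_delete A i 0 $$ (a, b) = A $$ (if a < i then a else Suc a, Suc b)"
      using a b A n by (simp add: mat_delete_def)
    \<comment> \<open>Deletion shifts every column by one but only the rows from \<open>i\<close>
      on. Upper right: \<open>a < i \<le> b\<close> puts \<open>Suc b\<close> beyond the
      superdiagonal, hence zero.\<close>
    also have "\<dots> = four_block_mat L (0\<^sub>m i m) C D $$ (a, b)"
    proof (cases "a < i")
      case True
      then show ?thesis
        using L D a b n by (auto simp: four_block_mat_def L_def A_index)
    next
      case False
      show ?thesis
      proof (cases "b < i")
        case True
        then show ?thesis
          using False L D a b by (auto simp: four_block_mat_def C_def)
      next
        case False': False
        \<comment> \<open>Row and column both move by \<open>i + 1\<close>. This keeps their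
          difference and is absorbed by the new starting time \<open>s + i + 1\<close>.\<close>
        have "D $$ (a - i, b - i) =
            (if b - i \<le> a - i \<and> a - i - (b - i) \<le> p - 1
             then \<phi> (a - i - (b - i) + 1) (s + int i + 1 + int (a - i + 1))
             else if b - i = a - i + 1 then - 1 else 0)"
          using False False' a b by (auto simp: D_def principal_matrix_def dim_D)
        also have "\<dots> = A $$ (Suc a, Suc b)"
          using False False' a b n by (auto simp: A_index algebra_simps of_nat_diff)
        finally show ?thesis
          using False False' L D a b by (simp add: four_block_mat_def)
      qed
    qed
    finally show "mat_delete A i 0 $$ (a, b) = four_block_mat L (0\<^sub>m i m) C D $$ (a, b)" .
  qed (use A L D n in auto)
  then have "Determinant.det (mat_delete A i 0) = Determinant.det L * Determinant.det D"
    using det_four_block_mat_upper_right_zero[OF L refl C D] by simp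
  \<comment> \<open>The diagonal of \<open>L\<close> is the superdiagonal of \<open>A\<close>. Its
    sign cancels the sign \<open>(- 1) ^ (i + 0)\<close> of the cofactor.\<close>
  moreover have "Determinant.det L = (- 1) ^ i"
  proof -
    have "Determinant.det L = prod_list (diag_mat L)"
      using n by (intro det_lower_triangular[OF _ L]) (auto simp: L_def A_index)
    also have "diag_mat L = map (\<lambda>_. - 1) [0..<i]"
      using n by (auto simp: diag_mat_def L_def A_index)
    finally show ?thesis
      by (simp add: map_replicate_const)
  qed
  ultimately have "cofactor A i 0 = Determinant.det D"
    by (simp add: cofactor_def flip: power_mult_distrib mult.assoc)
  also have "\<dots> = principal_det p \<phi> t (s + int i + 1)"
    using assms by (simp add: D_def principal_det_eq_det)
  finally show ?thesis
    by (simp add: A_def)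
qed

text \<open>Laplace expansion along the first column, whose entries vanish below row
  \<open>p\<close>; the cofactors are principal determinants with the same \<open>t\<close> and a
  later start.\<close>

lemma principal_det_backward:
  assumes "p \<ge> 1" "s < t"
  shows "principal_det p \<phi> t s =
    (\<Sum>r = 1..p. \<phi> r (s + int r) * principal_det p \<phi> t (s + int r))"
proof -
  define n where "n = nat (t - s)"
  have A: "principal_matrix p \<phi> t s \<in> carrier_mat n n"
    by (simp add: principal_matrix_def n_def)
  have "principal_det p \<phi> t s =
      (\<Sum>i<n. principal_matrix p \<phi> t s $$ (i, 0) * cofactor (principal_matrix p \<phi> t s) i 0)"
    using assms laplace_expansion_column[OF A, of 0] by (simp add: principal_det_eq_det n_def)
  also have "\<dots> = (\<Sum>i<n. if i < p
      then \<phi> (Suc i) (s + int (Suc i)) * principal_det p \<phi> t (s + int (Suc i)) else 0)"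
  proof (intro sum.cong refl)
    fix i assume "i \<in> {..<n}"
    moreover from this have "cofactor (principal_matrix p \<phi> t s) i 0
        = principal_det p \<phi> t (s + int (Suc i))"
      using cofactor_principal_matrix[of i t s p \<phi>] by (simp add: n_def add_ac)
    ultimately show "principal_matrix p \<phi> t s $$ (i, 0) * cofactor (principal_matrix p \<phi> t s) i 0
      = (if i < p then \<phi> (Suc i) (s + int (Suc i)) * principal_det p \<phi> t (s + int (Suc i)) else 0)"
      using assms by (auto simp: principal_matrix_def n_def)
  qed
  also have "\<dots> = (\<Sum>i\<in>{..<n} \<inter> {..<p}.
      \<phi> (Suc i) (s + int (Suc i)) * principal_det p \<phi> t (s + int (Suc i)))"
    by (subst sum.inter_restrict) simp_all
  \<comment> \<open>For \<open>i \<ge> n\<close> the start \<open>s + i + 1\<close> exceeds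
    \<open>t\<close>, so the added terms are zero and the range no longer depends on
    \<open>n\<close>.\<close>
  also have "\<dots> = (\<Sum>i<p. \<phi> (Suc i) (s + int (Suc i)) * principal_det p \<phi> t (s + int (Suc i)))"
    by (intro sum.mono_neutral_left) (auto intro!: principal_det_eq_0 simp: n_def not_less)
  also have "\<dots> = (\<Sum>r = 1..p. \<phi> r (s + int r) * principal_det p \<phi> t (s + int r))"
    by (intro sum.reindex_bij_witness[of _ "\<lambda>r. r - 1" Suc]) auto
  finally show ?thesis .
qed

text \<open>Derived from the recursion in \<open>s\<close> instead of a second cofactor expansion:
  expand in \<open>s\<close>, apply the induction hypothesis to each later start, swap the sums, and
  contract each inner sum by the recursion in \<open>s\<close> with end
  \<open>t - m\<close>.\<close>

lemma principal_det_forward: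
  assumes "p \<ge> 1" "s < t"
  shows "principal_det p \<phi> t s = (\<Sum>m = 1..p. \<phi> m t * principal_det p \<phi> (t - int m) s)"
  using assms(2)
proof (induction "nat (t - s)" arbitrary: s rule: less_induct)
  case less
  \<comment> \<open>The indicator repairs the homogeneous equation at start \<open>t\<close>, where
    the left side is 1 and all determinants on the right are 0.\<close>
  have step: "principal_det p \<phi> t (s + int r) = of_bool (s + int r = t)
      + (\<Sum>m = 1..p. \<phi> m t * principal_det p \<phi> (t - int m) (s + int r))" if "r \<in> {1..p}" for r
  proof -
    consider "s + int r < t" | "s + int r = t" | "t < s + int r"
      by linarith
    then show ?thesis
    proof cases
      case 1
      then show ?thesis
        using less.hyps[of "s + int r"] that by auto
    qed auto
  qed
  have "principal_det p \<phi> t s = (\<Sum>r = 1..p. \<phi> r (s + int r) * of_bool (s + int r = t))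
      + (\<Sum>r = 1..p. \<Sum>m = 1..p.
          \<phi> m t * (\<phi> r (s + int r) * principal_det p \<phi> (t - int m) (s + int r)))"
    unfolding principal_det_backward[OF \<open>p \<ge> 1\<close> less.prems] sum.distrib[symmetric]
    by (intro sum.cong refl) (simp add: step sum_distrib_left algebra_simps)
  also have "(\<Sum>r = 1..p. \<phi> r (s + int r) * of_bool (s + int r = t))
      = (\<Sum>m = 1..p. \<phi> m t * of_bool (t - int m = s))"
    by (intro sum.cong refl) auto
  also have "(\<Sum>r = 1..p. \<Sum>m = 1..p.
          \<phi> m t * (\<phi> r (s + int r) * principal_det p \<phi> (t - int m) (s + int r)))
      = (\<Sum>m = 1..p. \<phi> m t *
          (\<Sum>r = 1..p. \<phi> r (s + int r) * principal_det p \<phi> (t - int m) (s + int r)))"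
    by (subst sum.swap) (simp add: sum_distrib_left)
  also have "(\<Sum>m = 1..p. \<phi> m t * of_bool (t - int m = s)) + \<dots>
      = (\<Sum>m = 1..p. \<phi> m t * principal_det p \<phi> (t - int m) s)"
    unfolding sum.distrib[symmetric]
  proof (intro sum.cong refl)
    fix m
    \<comment> \<open>The transported indicator supplies the value 1 at \<open>t - m = s\<close>,
      the one case with \<open>s \<le> t - m\<close> in which the recursion in \<open>s\<close>
      fails.\<close>
    have "of_bool (t - int m = s)
        + (\<Sum>r = 1..p. \<phi> r (s + int r) * principal_det p \<phi> (t - int m) (s + int r))
        = principal_det p \<phi> (t - int m) s"
    proof -
      consider "s < t - int m" | "t - int m = s" | "t - int m < s"
        by linarith
      then show ?thesis
      proof cases
        case 1
        then show ?thesis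
          using principal_det_backward[OF \<open>p \<ge> 1\<close> 1, of \<phi>] by simp
      qed auto
    qed
    then show "\<phi> m t * of_bool (t - int m = s) + \<phi> m t *
        (\<Sum>r = 1..p. \<phi> r (s + int r) * principal_det p \<phi> (t - int m) (s + int r))
        = \<phi> m t * principal_det p \<phi> (t - int m) s"
      by (simp flip: distrib_left)
  qed
  finally show ?case .
qed

section \<open>Fundamental solutions and the explicit solution of the difference equation\<close>

lemma fundamental_sol_1:
  assumes "p \<ge> 1" "s < t"
  shows "fundamental_sol p \<phi> 1 t s = principal_det p \<phi> t s"
  using principal_det_backward[OF assms] by (simp add: fundamental_sol_def)

text \<open>Split off \<open>r = 1\<close> and shift the rest. This is how the coefficient of
  \<open>z (s - m)\<close> changes when \<open>z s\<close> is eliminated: \<open>z (s - m)\<close>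
  was already initial value number \<open>m + 1\<close>, and the equation at \<open>s\<close> adds
  \<open>\<phi> m s\<close> times the coefficient of \<open>z s\<close>.\<close>

lemma fundamental_sol_rec:
  assumes "1 \<le> m" "m \<le> p"
  shows "fundamental_sol p \<phi> m t (s - 1) =
    \<phi> m s * principal_det p \<phi> t s + fundamental_sol p \<phi> (Suc m) t s"
proof -
  have eq: "p + 1 - m = Suc (p + 1 - Suc m)"
    using assms by simp
  have "fundamental_sol p \<phi> m t (s - 1) = (\<Sum>r = 1..Suc (p + 1 - Suc m).
      \<phi> (m - 1 + r) (s - 1 + int r) * principal_det p \<phi> t (s - 1 + int r))"
    unfolding fundamental_sol_def eq by (rule refl)
  also have "\<dots> = \<phi> m s * principal_det p \<phi> t s + (\<Sum>r = Suc 1..Suc (p + 1 - Suc m).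
      \<phi> (m - 1 + r) (s - 1 + int r) * principal_det p \<phi> t (s - 1 + int r))"
    using assms by (subst sum.atLeast_Suc_atMost) auto
  also have "(\<Sum>r = Suc 1..Suc (p + 1 - Suc m).
      \<phi> (m - 1 + r) (s - 1 + int r) * principal_det p \<phi> t (s - 1 + int r))
      = fundamental_sol p \<phi> (Suc m) t s"
    unfolding fundamental_sol_def sum.shift_bounds_cl_Suc_ivl
    using assms by (intro sum.cong refl) auto
  finally show ?thesis .
qed

lemma fundamental_sol_Suc_order: "fundamental_sol p \<phi> (Suc p) t s = 0"
  by (simp add: fundamental_sol_def)

text \<open>
  Downward induction on \<open>s\<close>: moving from \<open>s\<close> to \<open>s - 1\<close> eliminates \<open>z s\<close> by means of the
  difference equation.
\<close>

lemma difference_equation_solution: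
  fixes z v :: "int \<Rightarrow> real"
  assumes "p \<ge> 1" "s < t"
    and z: "\<And>t. z t = v t + (\<Sum>m = 1..p. \<phi> m t * z (t - int m))"
  shows "z t = (\<Sum>m = 1..p. fundamental_sol p \<phi> m t s * z (s + 1 - int m))
    + (\<Sum>r = s + 1..t. principal_det p \<phi> t r * v r)"
proof -
  have "s \<le> t - 1"
    using assms by simp
  then show ?thesis
  proof (induction s rule: int_le_induct)
    case base
    \<comment> \<open>Only the term at start \<open>t\<close> survives, so the representation at
      \<open>s = t - 1\<close> is the difference equation itself.\<close>
    have "fundamental_sol p \<phi> m t (t - 1) = \<phi> m t" if "m \<in> {1..p}" for m
    proof -
      have "fundamental_sol p \<phi> (Suc m) t t = 0"
        by (simp add: fundamental_sol_def)
      then show ?thesis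
        using fundamental_sol_rec[of m p \<phi> t t] that by simp
    qed
    then have "(\<Sum>m = 1..p. fundamental_sol p \<phi> m t (t - 1) * z (t - 1 + 1 - int m))
        = (\<Sum>m = 1..p. \<phi> m t * z (t - int m))"
      by (intro sum.cong refl) simp
    then show ?case
      using z[of t] by simp
  next
    case (step s)
    define F where "F m = fundamental_sol p \<phi> m t s * z (s + 1 - int m)" for m
    have "s < t"
      using step by simp
    have "(\<Sum>m = 1..p. fundamental_sol p \<phi> m t (s - 1) * z (s - int m))
        = (\<Sum>m = 1..p. principal_det p \<phi> t s * (\<phi> m s * z (s - int m)) + F (Suc m))"
      by (intro sum.cong refl) (simp add: fundamental_sol_rec F_def algebra_simps)
    also have "\<dots> = principal_det p \<phi> t s * (z s - v s) + (\<Sum>m = 1..p. F (Suc m))"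
      using z[of s] by (simp add: sum.distrib sum_distrib_left)
    \<comment> \<open>Shifting loses \<open>F 1\<close> and gains \<open>F (Suc p)\<close>, which is
      an empty sum times a value of \<open>z\<close>.\<close>
    also have "(\<Sum>m = 1..p. F (Suc m)) = (\<Sum>m = 1..p. F m) - F 1"
    proof -
      have "(\<Sum>m = 1..p. F (Suc m)) = (\<Sum>m = Suc 1..Suc p. F m)"
        by (rule sum.shift_bounds_cl_Suc_ivl[symmetric])
      also have "\<dots> = (\<Sum>m = 1..Suc p. F m) - F 1"
        by (subst (2) sum.atLeast_Suc_atMost) auto
      also have "(\<Sum>m = 1..Suc p. F m) = (\<Sum>m = 1..p. F m)"
        by (simp add: F_def fundamental_sol_Suc_order)
      finally show ?thesis .
    qed
    \<comment> \<open>This cancels the \<open>z s\<close> just introduced; what remains is the new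
      summand with \<open>v s\<close>.\<close>
    also have "F 1 = principal_det p \<phi> t s * z s"
      using fundamental_sol_1[OF \<open>p \<ge> 1\<close> \<open>s < t\<close>] by (simp add: F_def)
    finally have "(\<Sum>m = 1..p. F m) = principal_det p \<phi> t s * v s
        + (\<Sum>m = 1..p. fundamental_sol p \<phi> m t (s - 1) * z (s - int m))"
      by (simp add: algebra_simps)
    moreover have "{s..t} = insert s {s + 1..t}"
      using \<open>s < t\<close> by auto
    ultimately show ?case
      using step.IH unfolding F_def by simp
  qed
qed

text \<open>The summand \<open>r = t\<close> contributes \<open>v t\<close>; for
  \<open>r < t\<close> the homogeneous equation in \<open>t\<close> applies. The cutoff
  \<open>s\<close> keeps everything finite until \<open>L2\<close> limits are taken.\<close>

lemma particular_solution_rec: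
  fixes v :: "int \<Rightarrow> real"
  assumes "p \<ge> 1" "s \<le> t"
  shows "(\<Sum>r = s..t. principal_det p \<phi> t r * v r) =
    v t + (\<Sum>m = 1..p. \<phi> m t * (\<Sum>r = s..t - int m. principal_det p \<phi> (t - int m) r * v r))"
proof -
  have "{s..t} = insert t {s..t - 1}"
    using assms by auto
  then have "(\<Sum>r = s..t. principal_det p \<phi> t r * v r)
      = v t + (\<Sum>r = s..t - 1. principal_det p \<phi> t r * v r)"
    by simp
  also have "(\<Sum>r = s..t - 1. principal_det p \<phi> t r * v r)
      = (\<Sum>r = s..t - 1. \<Sum>m = 1..p. \<phi> m t * (principal_det p \<phi> (t - int m) r * v r))"
    by (intro sum.cong refl)
      (simp add: principal_det_forward[OF \<open>p \<ge> 1\<close>] sum_distrib_right mult.assoc)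
  also have "\<dots> = (\<Sum>m = 1..p. \<phi> m t * (\<Sum>r = s..t - 1. principal_det p \<phi> (t - int m) r * v r))"
    by (subst sum.swap) (simp add: sum_distrib_left)
  \<comment> \<open>The upper limit drops from \<open>t - 1\<close> to \<open>t - m\<close> because
    the determinant vanishes when its start exceeds its end.\<close>
  also have "\<dots> = (\<Sum>m = 1..p. \<phi> m t *
      (\<Sum>r = s..t - int m. principal_det p \<phi> (t - int m) r * v r))"
    by (intro sum.cong refl arg_cong2[where f = "(*)"] sum.mono_neutral_right) auto
  finally show ?thesis .
qed

section \<open>Convergence in \<open>L2\<close>\<close>

text \<open>Takes the place of the \<open>L2\<close> triangle inequality; the factor 2 is harmless
  when both terms tend to 0.\<close>

lemma power2_add_le: "(a + b)\<^sup>2 \<le> 2 * a\<^sup>2 + 2 * b\<^sup>2" for a b :: real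
  using sum_squares_bound[of a b] by (simp add: power2_sum)

lemma L2_cmult:
  assumes "f \<in> L2 M"
  shows "(\<lambda>x. c * f x) \<in> L2 M"
  using assms by (auto simp: L2_def power_mult_distrib)

lemma L2_add:
  assumes "f \<in> L2 M" "g \<in> L2 M"
  shows "(\<lambda>x. f x + g x) \<in> L2 M"
proof -
  have [measurable]: "f \<in> borel_measurable M" "g \<in> borel_measurable M"
    using assms by (auto simp: L2_def)
  have "integrable M (\<lambda>x. 2 * (f x)\<^sup>2 + 2 * (g x)\<^sup>2)"
    using assms by (auto simp: L2_def)
  then have "integrable M (\<lambda>x. (f x + g x)\<^sup>2)"
    by (rule Bochner_Integration.integrable_bound) (auto simp: power2_add_le)
  then show ?thesis
    by (simp add: L2_def)
qed

lemma L2_diff: "f \<in> L2 M \<Longrightarrow> g \<in> L2 M \<Longrightarrow> (\<lambda>x. f x - g x) \<in> L2 M"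
  using L2_add[of f M "\<lambda>x. - 1 * g x"] L2_cmult[of g M "- 1"] by simp

lemma L2_zero: "(\<lambda>x. 0) \<in> L2 M"
  by (simp add: L2_def)

lemma L2_const: "finite_measure M \<Longrightarrow> (\<lambda>x. c) \<in> L2 M"
  by (simp add: L2_def finite_measure.integrable_const)

lemma L2_sum: "(\<And>i. i \<in> I \<Longrightarrow> f i \<in> L2 M) \<Longrightarrow> (\<lambda>x. \<Sum>i\<in>I. f i x) \<in> L2 M"
  by (induction I rule: infinite_finite_induct) (auto intro: L2_zero L2_add)

lemma integral_power2_add_le:
  assumes "f \<in> L2 M" "g \<in> L2 M"
  shows "(\<integral>x. (f x + g x)\<^sup>2 \<partial>M) \<le> 2 * (\<integral>x. (f x)\<^sup>2 \<partial>M) + 2 * (\<integral>x. (g x)\<^sup>2 \<partial>M)"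
proof -
  have "(\<integral>x. (f x + g x)\<^sup>2 \<partial>M) \<le> (\<integral>x. 2 * (f x)\<^sup>2 + 2 * (g x)\<^sup>2 \<partial>M)"
    using assms L2_add[OF assms] by (intro integral_mono) (auto simp: L2_def power2_add_le)
  then show ?thesis
    using assms by (simp add: L2_def)
qed

lemma tendsto_L2_add:
  assumes X: "tendsto_L2 M X Y F" and X': "tendsto_L2 M X' Y' F"
  shows "tendsto_L2 M (\<lambda>i x. X i x + X' i x) (\<lambda>x. Y x + Y' x) F"
proof -
  have L2: "X i \<in> L2 M" "Y \<in> L2 M" "X' i \<in> L2 M" "Y' \<in> L2 M" for i
    using assms by (auto simp: tendsto_L2_def)
  have "((\<lambda>i. 2 * (\<integral>x. (X i x - Y x)\<^sup>2 \<partial>M) + 2 * (\<integral>x. (X' i x - Y' x)\<^sup>2 \<partial>M)) \<longlongrightarrow> 2 * 0 + 2 * 0) F"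
    using assms by (intro tendsto_intros) (auto simp: tendsto_L2_def)
  then have upper:
    "((\<lambda>i. 2 * (\<integral>x. (X i x - Y x)\<^sup>2 \<partial>M) + 2 * (\<integral>x. (X' i x - Y' x)\<^sup>2 \<partial>M)) \<longlongrightarrow> 0) F"
    by simp
  have "(\<integral>x. (X i x + X' i x - (Y x + Y' x))\<^sup>2 \<partial>M)
      \<le> 2 * (\<integral>x. (X i x - Y x)\<^sup>2 \<partial>M) + 2 * (\<integral>x. (X' i x - Y' x)\<^sup>2 \<partial>M)" for i
    using integral_power2_add_le[OF L2_diff L2_diff, OF L2(1,2) L2(3,4), of i i]
    by (simp add: algebra_simps)
  then have "((\<lambda>i. \<integral>x. (X i x + X' i x - (Y x + Y' x))\<^sup>2 \<partial>M) \<longlongrightarrow> 0) F"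
    by (intro tendsto_sandwich[OF _ _ tendsto_const upper] always_eventually allI) simp_all
  then show ?thesis
    using L2 by (simp add: tendsto_L2_def L2_add)
qed

lemma tendsto_L2_cmult:
  assumes "tendsto_L2 M X Y F"
  shows "tendsto_L2 M (\<lambda>i x. c * X i x) (\<lambda>x. c * Y x) F"
proof -
  have "(c * X i x - c * Y x)\<^sup>2 = c\<^sup>2 * (X i x - Y x)\<^sup>2" for i x
    by (simp add: power_mult_distrib flip: right_diff_distrib)
  then show ?thesis
    using assms by (auto simp: tendsto_L2_def L2_cmult intro: tendsto_mult_right_zero)
qed

lemma tendsto_L2_const: "Y \<in> L2 M \<Longrightarrow> tendsto_L2 M (\<lambda>i. Y) Y F"
  by (simp add: tendsto_L2_def)

lemma tendsto_L2_sum: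
  "(\<And>i. i \<in> I \<Longrightarrow> tendsto_L2 M (X i) (Y i) F) \<Longrightarrow>
    tendsto_L2 M (\<lambda>n x. \<Sum>i\<in>I. X i n x) (\<lambda>x. \<Sum>i\<in>I. Y i x) F"
  by (induction I rule: infinite_finite_induct)
    (auto intro: tendsto_L2_add tendsto_L2_const L2_zero)

lemma tendsto_L2_diff:
  "tendsto_L2 M X Y F \<Longrightarrow> tendsto_L2 M X' Y' F \<Longrightarrow>
    tendsto_L2 M (\<lambda>i x. X i x - X' i x) (\<lambda>x. Y x - Y' x) F"
  using tendsto_L2_add[of M X Y F "\<lambda>i x. - 1 * X' i x" "\<lambda>x. - 1 * Y' x"]
    tendsto_L2_cmult[of M X' Y' F "- 1"] by simp

lemma tendsto_L2_of_tendsto: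
  assumes "finite_measure M" "(a \<longlongrightarrow> b) F"
  shows "tendsto_L2 M (\<lambda>i x. a i) (\<lambda>x. b) F"
proof -
  have "((\<lambda>i. (a i - b)\<^sup>2 * measure M (space M)) \<longlongrightarrow> (b - b)\<^sup>2 * measure M (space M)) F"
    by (intro tendsto_intros assms(2))
  then show ?thesis
    using assms(1) by (simp add: tendsto_L2_def L2_const mult.commute)
qed

lemma tendsto_L2_compose:
  assumes "tendsto_L2 M X Y F" "filterlim g F G"
  shows "tendsto_L2 M (\<lambda>i. X (g i)) Y G"
  using assms filterlim_compose[of "\<lambda>i. \<integral>x. (X i x - Y x)\<^sup>2 \<partial>M" _ F g G]
  by (auto simp: tendsto_L2_def)

text \<open>Membership in \<open>L2\<close> is assumed separately: almost sure equality does not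
  transfer measurability, and it is given only for eventual indices.\<close>

lemma tendsto_L2_cong_AE:
  assumes X: "tendsto_L2 M X Y F" and X': "eventually (\<lambda>i. AE x in M. X' i x = X i x) F"
    and Y': "AE x in M. Y' x = Y x" and L2: "\<And>i. X' i \<in> L2 M" "Y' \<in> L2 M"
  shows "tendsto_L2 M X' Y' F"
proof -
  have "eventually (\<lambda>i. (\<integral>x. (X' i x - Y' x)\<^sup>2 \<partial>M) = (\<integral>x. (X i x - Y x)\<^sup>2 \<partial>M)) F"
    using X'
  proof eventually_elim
    case (elim i)
    have [measurable]: "X' i \<in> borel_measurable M" "X i \<in> borel_measurable M"
      "Y' \<in> borel_measurable M" "Y \<in> borel_measurable M"
      using X L2 by (auto simp: tendsto_L2_def L2_def)
    show ?case
      using elim Y' by (intro integral_cong_AE) auto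
  qed
  then show ?thesis
    using X L2 by (simp add: tendsto_L2_def tendsto_cong)
qed

text \<open>Subtracting the two limits makes the zero sequence converge to \<open>Y - Y'\<close>,
  whose squared norm is therefore 0.\<close>

lemma tendsto_L2_unique:
  assumes "tendsto_L2 M X Y F" "tendsto_L2 M X Y' F" "F \<noteq> bot"
  shows "AE x in M. Y x = Y' x"
proof -
  have L2: "(\<lambda>x. Y x - Y' x) \<in> L2 M"
    using assms by (auto simp: tendsto_L2_def intro: L2_diff)
  have "tendsto_L2 M (\<lambda>i x. 0) (\<lambda>x. Y x - Y' x) F"
    using tendsto_L2_diff[OF assms(1,2)] by simp
  then have "(\<integral>x. (Y x - Y' x)\<^sup>2 \<partial>M) = 0"
    using assms(3) by (simp add: tendsto_L2_def tendsto_const_iff power2_commute)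
  then have "AE x in M. (Y x - Y' x)\<^sup>2 = 0"
    using L2 by (subst (asm) integral_nonneg_eq_0_iff_AE) (auto simp: L2_def)
  then show ?thesis
    by eventually_elim simp
qed

section \<open>Series in \<open>L2\<close> with absolutely summable weights\<close>

text \<open>Half of each weight goes to either factor. The bound is linear in the squares
  \<open>(x n)\<^sup>2\<close>, so it can be integrated term by term.\<close>

lemma suminf_Cauchy_Schwarz_weighted:
  fixes c x :: "nat \<Rightarrow> real"
  assumes c: "summable (\<lambda>n. \<bar>c n\<bar>)" and cx: "summable (\<lambda>n. \<bar>c n\<bar> * (x n)\<^sup>2)"
  shows "summable (\<lambda>n. c n * x n)"
    and "(\<Sum>n. c n * x n)\<^sup>2 \<le> (\<Sum>n. \<bar>c n\<bar>) * (\<Sum>n. \<bar>c n\<bar> * (x n)\<^sup>2)"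
proof -
  \<comment> \<open>Bounds the terms by the sum of the two given summable series.\<close>
  have "\<bar>x n\<bar> \<le> 1 + (x n)\<^sup>2" for n
    using sum_squares_bound[of 1 "\<bar>x n\<bar>"] by simp
  then have "\<bar>c n\<bar> * \<bar>x n\<bar> \<le> \<bar>c n\<bar> * (1 + (x n)\<^sup>2)" for n
    by (intro mult_left_mono) auto
  then have "norm (c n * x n) \<le> \<bar>c n\<bar> + \<bar>c n\<bar> * (x n)\<^sup>2" for n
    by (simp add: abs_mult distrib_left)
  then show summable: "summable (\<lambda>n. c n * x n)"
    by (intro summable_comparison_test'[OF summable_add[OF c cx]])
  show "(\<Sum>n. c n * x n)\<^sup>2 \<le> (\<Sum>n. \<bar>c n\<bar>) * (\<Sum>n. \<bar>c n\<bar> * (x n)\<^sup>2)"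
  proof (rule LIMSEQ_le)
    show "(\<lambda>N. (\<Sum>n<N. c n * x n)\<^sup>2) \<longlonglongrightarrow> (\<Sum>n. c n * x n)\<^sup>2"
      by (intro tendsto_intros summable_LIMSEQ summable)
    show "(\<lambda>N. (\<Sum>n<N. \<bar>c n\<bar>) * (\<Sum>n<N. \<bar>c n\<bar> * (x n)\<^sup>2))
        \<longlonglongrightarrow> (\<Sum>n. \<bar>c n\<bar>) * (\<Sum>n. \<bar>c n\<bar> * (x n)\<^sup>2)"
      by (intro tendsto_intros summable_LIMSEQ c cx)
    have "(\<Sum>n<N. c n * x n)\<^sup>2 \<le> (\<Sum>n<N. \<bar>c n\<bar>) * (\<Sum>n<N. \<bar>c n\<bar> * (x n)\<^sup>2)" for N
    proof -
      have "c n * x n = (sgn (c n) * sqrt \<bar>c n\<bar>) * (sqrt \<bar>c n\<bar> * x n)" for n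
      proof -
        have "(sgn (c n) * sqrt \<bar>c n\<bar>) * (sqrt \<bar>c n\<bar> * x n)
            = sgn (c n) * (sqrt \<bar>c n\<bar> * sqrt \<bar>c n\<bar>) * x n"
          by (simp only: mult.assoc)
        then show ?thesis
          by (simp add: sgn_mult_abs)
      qed
      moreover have "(sgn (c n) * sqrt \<bar>c n\<bar>)\<^sup>2 = \<bar>c n\<bar>" for n
        by (simp add: power_mult_distrib sgn_if)
      moreover have "(sqrt \<bar>c n\<bar> * x n)\<^sup>2 = \<bar>c n\<bar> * (x n)\<^sup>2" for n
        by (simp add: power_mult_distrib)
      ultimately show ?thesis
        using Cauchy_Schwarz_ineq_sum[of "\<lambda>n. sgn (c n) * sqrt \<bar>c n\<bar>" "\<lambda>n. sqrt \<bar>c n\<bar> * x n" "{..<N}"]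
        by (simp only:)
    qed
    then show "\<exists>N. \<forall>n\<ge>N. (\<Sum>n<n. c n * x n)\<^sup>2 \<le> (\<Sum>n<n. \<bar>c n\<bar>) * (\<Sum>n<n. \<bar>c n\<bar> * (x n)\<^sup>2)"
      by (intro exI allI impI)
  qed
qed

text \<open>The weighted squares have total integral at most \<open>T * K\<close>, so they are
  summable almost surely. Cauchy-Schwarz then gives convergence of the series, and integrating it
  costs another factor \<open>T\<close>. Applied to shifted sequences, this bounds tails.\<close>

lemma L2_series_tail_bound:
  fixes c :: "nat \<Rightarrow> real" and X :: "nat \<Rightarrow> 'a \<Rightarrow> real"
  assumes X: "\<And>n. X n \<in> L2 M" and K: "\<And>n. (\<integral>x. (X n x)\<^sup>2 \<partial>M) \<le> K"
    and c: "summable (\<lambda>n. \<bar>c n\<bar>)"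
  shows "AE x in M. summable (\<lambda>n. c n * X n x)"
    and "(\<lambda>x. \<Sum>n. c n * X n x) \<in> L2 M"
    and "(\<integral>x. (\<Sum>n. c n * X n x)\<^sup>2 \<partial>M) \<le> (\<Sum>n. \<bar>c n\<bar>)\<^sup>2 * K"
proof -
  have [measurable]: "X n \<in> borel_measurable M" for n
    using X by (simp add: L2_def)
  have K0: "0 \<le> K"
    using K[of 0] by (rule order_trans[rotated]) simp
  define T where "T = (\<Sum>n. \<bar>c n\<bar>)"
  have T0: "0 \<le> T"
    unfolding T_def by (intro suminf_nonneg c) simp
  have "(\<integral>\<^sup>+x. (\<Sum>n. ennreal (\<bar>c n\<bar> * (X n x)\<^sup>2)) \<partial>M)
      = (\<Sum>n. \<integral>\<^sup>+x. ennreal (\<bar>c n\<bar> * (X n x)\<^sup>2) \<partial>M)"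
    by (intro nn_integral_suminf) simp
  also have "\<dots> = (\<Sum>n. ennreal (\<bar>c n\<bar> * (\<integral>x. (X n x)\<^sup>2 \<partial>M)))"
    using X by (subst nn_integral_eq_integral) (auto simp: L2_def)
  also have "\<dots> \<le> (\<Sum>n. ennreal (\<bar>c n\<bar> * K))"
    by (intro suminf_le ennreal_leI mult_left_mono K) auto
  also have "\<dots> = ennreal (T * K)"
    unfolding T_def using c K0
    by (subst suminf_ennreal2) (auto simp: suminf_mult2 summable_mult2)
  finally have bound: "(\<integral>\<^sup>+x. (\<Sum>n. ennreal (\<bar>c n\<bar> * (X n x)\<^sup>2)) \<partial>M) \<le> ennreal (T * K)" .
  then have "(\<integral>\<^sup>+x. (\<Sum>n. ennreal (\<bar>c n\<bar> * (X n x)\<^sup>2)) \<partial>M) \<noteq> \<infinity>"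
    unfolding infinity_ennreal_def by (rule neq_top_trans[OF ennreal_neq_top])
  then have "AE x in M. (\<Sum>n. ennreal (\<bar>c n\<bar> * (X n x)\<^sup>2)) \<noteq> \<infinity>"
    by (intro nn_integral_noteq_infinite) auto
  then have AE: "AE x in M. summable (\<lambda>n. \<bar>c n\<bar> * (X n x)\<^sup>2)"
    by eventually_elim (auto intro!: summable_suminf_not_top)
  then show "AE x in M. summable (\<lambda>n. c n * X n x)"
    by eventually_elim (rule suminf_Cauchy_Schwarz_weighted(1)[OF c])
  \<comment> \<open>The nonnegative integral is bounded first, since this yields integrability as
    well as the bound on the Bochner integral.\<close>
  have "(\<integral>\<^sup>+x. ennreal ((\<Sum>n. c n * X n x)\<^sup>2) \<partial>M)
      \<le> (\<integral>\<^sup>+x. ennreal T * (\<Sum>n. ennreal (\<bar>c n\<bar> * (X n x)\<^sup>2)) \<partial>M)"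
  proof (rule nn_integral_mono_AE)
    show "AE x in M. ennreal ((\<Sum>n. c n * X n x)\<^sup>2)
        \<le> ennreal T * (\<Sum>n. ennreal (\<bar>c n\<bar> * (X n x)\<^sup>2))"
      using AE
    proof eventually_elim
      case (elim x)
      have "(\<Sum>n. ennreal (\<bar>c n\<bar> * (X n x)\<^sup>2)) = ennreal (\<Sum>n. \<bar>c n\<bar> * (X n x)\<^sup>2)"
        using elim by (intro suminf_ennreal2) auto
      then show ?case
        using suminf_Cauchy_Schwarz_weighted(2)[OF c elim] T0
        by (auto simp: T_def suminf_nonneg elim simp flip: ennreal_mult intro!: ennreal_leI)
    qed
  qed
  also have "\<dots> = ennreal T * (\<integral>\<^sup>+x. (\<Sum>n. ennreal (\<bar>c n\<bar> * (X n x)\<^sup>2)) \<partial>M)"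
    by (intro nn_integral_cmult) measurable
  also have "\<dots> \<le> ennreal T * ennreal (T * K)"
    by (intro mult_left_mono bound) simp
  also have "\<dots> = ennreal (T\<^sup>2 * K)"
    using T0 K0 by (simp add: power2_eq_square mult.assoc flip: ennreal_mult)
  finally have le: "(\<integral>\<^sup>+x. ennreal ((\<Sum>n. c n * X n x)\<^sup>2) \<partial>M) \<le> ennreal (T\<^sup>2 * K)" .
  then show "(\<integral>x. (\<Sum>n. c n * X n x)\<^sup>2 \<partial>M) \<le> (\<Sum>n. \<bar>c n\<bar>)\<^sup>2 * K"
    using K0 unfolding T_def by (intro integral_real_bounded) auto
  have "integrable M (\<lambda>x. (\<Sum>n. c n * X n x)\<^sup>2)"
    using le by (intro integrableI_bounded) (auto intro: order.strict_trans1)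
  then show "(\<lambda>x. \<Sum>n. c n * X n x) \<in> L2 M"
    by (simp add: L2_def)
qed

lemma tendsto_L2_partial_sums:
  fixes c :: "nat \<Rightarrow> real" and X :: "nat \<Rightarrow> 'a \<Rightarrow> real"
  assumes X: "\<And>n. X n \<in> L2 M" and K: "\<And>n. (\<integral>x. (X n x)\<^sup>2 \<partial>M) \<le> K"
    and c: "summable (\<lambda>n. \<bar>c n\<bar>)"
  shows "tendsto_L2 M (\<lambda>N x. \<Sum>n<N. c n * X n x) (\<lambda>x. \<Sum>n. c n * X n x) sequentially"
proof -
  have S: "(\<lambda>x. \<Sum>n. c n * X n x) \<in> L2 M"
    by (rule L2_series_tail_bound(2)[OF X K c])
  have P: "(\<lambda>x. \<Sum>n<N. c n * X n x) \<in> L2 M" for N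
    by (intro L2_sum L2_cmult X)
  have bound: "(\<integral>x. ((\<Sum>n<N. c n * X n x) - (\<Sum>n. c n * X n x))\<^sup>2 \<partial>M)
      \<le> (\<Sum>n. \<bar>c (n + N)\<bar>)\<^sup>2 * K" for N
  proof -
    have cN: "summable (\<lambda>n. \<bar>c (n + N)\<bar>)"
      using c by (rule summable_ignore_initial_segment)
    note tail = L2_series_tail_bound[of "\<lambda>n. X (n + N)" M K "\<lambda>n. c (n + N)", OF X K cN]
    have [measurable]: "X n \<in> borel_measurable M" for n
      using X by (simp add: L2_def)
    have "(\<integral>x. ((\<Sum>n<N. c n * X n x) - (\<Sum>n. c n * X n x))\<^sup>2 \<partial>M)
        = (\<integral>x. (\<Sum>n. c (n + N) * X (n + N) x)\<^sup>2 \<partial>M)"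
    \<comment> \<open>The error equals the tail only where the series converges; elsewhere
      \<open>suminf\<close> has no meaningful value.\<close>
    proof (rule integral_cong_AE)
      show "AE x in M. ((\<Sum>n<N. c n * X n x) - (\<Sum>n. c n * X n x))\<^sup>2
          = (\<Sum>n. c (n + N) * X (n + N) x)\<^sup>2"
        using L2_series_tail_bound(1)[of X M K c, OF X K c]
      proof eventually_elim
        case (elim x)
        show ?case
          using suminf_split_initial_segment[OF elim, of N] by (simp add: power2_commute)
      qed
    qed measurable
    then show ?thesis
      using tail(3) by simp
  qed
  have "(\<lambda>N. (\<Sum>n. \<bar>c (n + N)\<bar>)\<^sup>2 * K) \<longlonglongrightarrow> 0\<^sup>2 * K"
    by (intro tendsto_intros suminf_exist_split2[OF c])
  then have upper: "(\<lambda>N. (\<Sum>n. \<bar>c (n + N)\<bar>)\<^sup>2 * K) \<longlonglongrightarrow> 0"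
    by simp
  have "(\<lambda>N. \<integral>x. ((\<Sum>n<N. c n * X n x) - (\<Sum>n. c n * X n x))\<^sup>2 \<partial>M) \<longlonglongrightarrow> 0"
    by (intro tendsto_sandwich[OF _ _ tendsto_const upper] always_eventually allI bound) simp
  then show ?thesis
    using S P by (simp add: tendsto_L2_def)
qed

section \<open>Sums over the integers up to \<open>t\<close> as series over the naturals\<close>

lemma filterlim_nat_diff_at_bot: "filterlim (\<lambda>s. nat (t + 1 - s)) sequentially at_bot"
proof (subst filterlim_at_top, intro allI)
  fix N
  have "eventually (\<lambda>s. s \<le> t - int N) at_bot"
    by (rule eventually_le_at_bot)
  then show "eventually (\<lambda>s. N \<le> nat (t + 1 - s)) at_bot"
    by eventually_elim linarith
qed

lemma filterlim_int_add_at_bot: "filterlim (\<lambda>s. s + d :: int) at_bot at_bot"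
  unfolding filterlim_at_bot
proof
  fix Z
  have "eventually (\<lambda>s. s \<le> Z - d) at_bot"
    by (rule eventually_le_at_bot)
  then show "eventually (\<lambda>s. s + d \<le> Z) at_bot"
    by eventually_elim simp
qed

text \<open>Counting runs backwards from \<open>t\<close>, so \<open>s\<close> tending to minus
  infinity means ever more terms. For \<open>s > t\<close>, \<open>nat\<close> clips to 0 and both
  sums are empty.\<close>

lemma sum_int_interval_eq: "(\<Sum>r = s..t. f r) = (\<Sum>n<nat (t + 1 - s). f (t - int n))"
  by (intro sum.reindex_bij_witness[of _ "\<lambda>n. t - int n" "\<lambda>r. nat (t - r)"]) auto

lemma bij_betw_nat_int_atMost: "bij_betw (\<lambda>n. t - int n) UNIV {..t}"
  by (rule bij_betwI[of _ _ _ "\<lambda>r. nat (t - r)"]) auto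

lemma summable_on_int_atMost_imp_summable:
  fixes f :: "int \<Rightarrow> real"
  assumes "f summable_on {..t}"
  shows "summable (\<lambda>n. f (t - int n))"
  using assms summable_on_reindex_bij_betw[OF bij_betw_nat_int_atMost, of f t]
  by (auto intro: summable_on_imp_summable)

lemma L2_sums_upto_exists:
  assumes "\<And>r. X r \<in> L2 M" and "\<And>r. (\<integral>x. (X r x)\<^sup>2 \<partial>M) \<le> K"
    and "(\<lambda>r. \<bar>c r\<bar>) summable_on {..t}"
  obtains S where "L2_sums_upto M (\<lambda>r x. c r * X r x) t S"
proof
  have "summable (\<lambda>n. \<bar>c (t - int n)\<bar>)"
    using assms(3) by (rule summable_on_int_atMost_imp_summable)
  then have "tendsto_L2 M (\<lambda>N x. \<Sum>n<N. c (t - int n) * X (t - int n) x)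
      (\<lambda>x. \<Sum>n. c (t - int n) * X (t - int n) x) sequentially"
    by (intro tendsto_L2_partial_sums[where K = K] assms(1,2))
  from tendsto_L2_compose[OF this filterlim_nat_diff_at_bot]
  show "L2_sums_upto M (\<lambda>r x. c r * X r x) t (\<lambda>x. \<Sum>n. c (t - int n) * X (t - int n) x)"
    by (simp add: L2_sums_upto_def sum_int_interval_eq)
qed

text \<open>Links the unordered sum in the final formula to the one-sided interval limits behind
  \<open>L2_sums_upto\<close>.\<close>

lemma tendsto_sum_infsum_int_atMost:
  fixes f :: "int \<Rightarrow> real"
  assumes "f summable_on {..t}"
  shows "((\<lambda>s. \<Sum>r = s..t. f r) \<longlongrightarrow> (\<Sum>\<^sub>\<infinity>r\<in>{..t}. f r)) at_bot"
proof -
  have "(f has_sum (\<Sum>\<^sub>\<infinity>r\<in>{..t}. f r)) {..t}"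
    using assms by (rule has_sum_infsum)
  then have "((\<lambda>n. f (t - int n)) has_sum (\<Sum>\<^sub>\<infinity>r\<in>{..t}. f r)) UNIV"
    using has_sum_reindex_bij_betw[OF bij_betw_nat_int_atMost, of f] by blast
  then have "(\<lambda>N. \<Sum>n<N. f (t - int n)) \<longlonglongrightarrow> (\<Sum>\<^sub>\<infinity>r\<in>{..t}. f r)"
    using has_sum_imp_sums sums_def by blast
  from filterlim_compose[OF this filterlim_nat_diff_at_bot] show ?thesis
    by (simp add: sum_int_interval_eq)
qed

lemma summable_on_bounded_mult:
  fixes f g :: "int \<Rightarrow> real"
  assumes f: "(\<lambda>r. \<bar>f r\<bar>) summable_on A" and g: "bounded (range g)"
  shows "(\<lambda>r. \<bar>f r * g r\<bar>) summable_on A"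
proof -
  from g obtain B where B: "\<And>r. \<bar>g r\<bar> \<le> B"
    by (auto simp: bounded_iff)
  have "(\<lambda>r. \<bar>f r\<bar> * B) summable_on A"
    by (rule summable_on_cmult_left[OF f])
  then show ?thesis
    by (rule summable_on_comparison_test) (auto simp: abs_mult intro: mult_left_mono B)
qed

section \<open>Stable solutions\<close>

text \<open>Collects lagged errors by their own time, which produces the coefficients of
  \<open>principal_det_ma\<close>. Both sums may end at \<open>t\<close> because starts beyond
  \<open>t\<close> contribute 0.\<close>

lemma sum_principal_det_lag_shift:
  fixes u :: "int \<Rightarrow> real"
  shows "(\<Sum>r = s + int l..t. principal_det p \<phi> t r * \<theta> r * u (r - int l))
    = (\<Sum>r = s..t. principal_det p \<phi> t (r + int l) * \<theta> (r + int l) * u r)"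
proof -
  have "(\<Sum>r = s + int l..t. principal_det p \<phi> t r * \<theta> r * u (r - int l))
      = (\<Sum>r = s..t - int l. principal_det p \<phi> t (r + int l) * \<theta> (r + int l) * u r)"
    by (intro sum.reindex_bij_witness[of _ "\<lambda>r. r + int l" "\<lambda>r. r - int l"]) auto
  also have "\<dots> = (\<Sum>r = s..t. principal_det p \<phi> t (r + int l) * \<theta> (r + int l) * u r)"
    by (intro sum.mono_neutral_left) auto
  finally show ?thesis .
qed

text \<open>The whole forcing term, intercept included: it plays the role of \<open>v\<close> in the
  deterministic lemmas and turns the model into a purely autoregressive equation.\<close>

definition tvarma_innovation ::
    "nat \<Rightarrow> (int \<Rightarrow> real) \<Rightarrow> (nat \<Rightarrow> int \<Rightarrow> real) \<Rightarrow> (int \<Rightarrow> 'a \<Rightarrow> real) \<Rightarrow> int \<Rightarrow> 'a \<Rightarrow> real" where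
  "tvarma_innovation q \<mu> \<theta> \<epsilon> r x = \<mu> r + \<epsilon> r x + (\<Sum>l = 1..q. \<theta> l r * \<epsilon> (r - int l) x)"

lemma tvarma_innovation_L2:
  assumes "finite_measure M" "\<And>t. \<epsilon> t \<in> L2 M"
  shows "tvarma_innovation q \<mu> \<theta> \<epsilon> r \<in> L2 M"
  unfolding tvarma_innovation_def by (intro L2_add L2_sum L2_cmult L2_const assms)

lemma solves_tvarma_iff:
  "solves_tvarma M p q \<mu> \<phi> \<theta> \<epsilon> y \<longleftrightarrow>
    (\<forall>t. AE x in M. y t x = tvarma_innovation q \<mu> \<theta> \<epsilon> t x + (\<Sum>m = 1..p. \<phi> m t * y (t - int m) x))"
  by (simp add: solves_tvarma_def tvarma_innovation_def algebra_simps)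

text \<open>Each lag gives its own convergent series, since a bounded \<open>\<theta> l\<close>
  preserves absolute summability. Adding the limits serves both groupings at once.\<close>

lemma L2_sums_upto_innovations:
  assumes M: "prob_space M" and \<epsilon>: "\<And>t. \<epsilon> t \<in> L2 M" and B: "\<And>t. (\<integral>x. (\<epsilon> t x)\<^sup>2 \<partial>M) \<le> B"
    and \<xi>: "(\<lambda>r. \<bar>principal_det p \<phi> t r\<bar>) summable_on {..t}"
    and \<mu>: "bounded (range \<mu>)" and \<theta>: "\<And>l. 1 \<le> l \<Longrightarrow> l \<le> q \<Longrightarrow> bounded (range (\<theta> l))"
  obtains S where "L2_sums_upto M (\<lambda>r x. principal_det_ma p q \<phi> \<theta> t r * \<epsilon> r x) t S"
    and "L2_sums_upto M (\<lambda>r x. principal_det p \<phi> t r * tvarma_innovation q \<mu> \<theta> \<epsilon> r x) t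
      (\<lambda>x. (\<Sum>\<^sub>\<infinity>r\<in>{..t}. principal_det p \<phi> t r * \<mu> r) + S x)"
proof -
  interpret prob_space M by (rule M)
  define \<xi> where "\<xi> = principal_det p \<phi> t"
  obtain S0 where S0: "tendsto_L2 M (\<lambda>s x. \<Sum>r = s..t. \<xi> r * \<epsilon> r x) S0 at_bot"
    using L2_sums_upto_exists[of \<epsilon> M B \<xi> t, OF \<epsilon> B] \<xi>
    unfolding L2_sums_upto_def \<xi>_def by metis
  have "\<exists>S. tendsto_L2 M (\<lambda>s x. \<Sum>r = s..t. \<xi> r * \<theta> l r * \<epsilon> (r - int l) x) S at_bot"
    if "l \<in> {1..q}" for l
  proof -
    have "(\<lambda>r. \<bar>\<xi> r * \<theta> l r\<bar>) summable_on {..t}"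
      using summable_on_bounded_mult[OF \<xi> \<theta>[of l]] that by (simp add: \<xi>_def)
    from L2_sums_upto_exists[of "\<lambda>r. \<epsilon> (r - int l)" M B "\<lambda>r. \<xi> r * \<theta> l r" t, OF \<epsilon> B this]
    show ?thesis
      unfolding L2_sums_upto_def by metis
  qed
  then obtain S where S: "\<And>l. l \<in> {1..q} \<Longrightarrow>
      tendsto_L2 M (\<lambda>s x. \<Sum>r = s..t. \<xi> r * \<theta> l r * \<epsilon> (r - int l) x) (S l) at_bot"
    by metis
  define S\<^sub>q where "S\<^sub>q = (\<lambda>x. S0 x + (\<Sum>l = 1..q. S l x))"
  \<comment> \<open>The two groupings of a finite sum differ at the lower end. Replacing
    \<open>s\<close> by \<open>s + l\<close> removes the difference without changing the
    limit.\<close>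
  have "tendsto_L2 M (\<lambda>s x. \<Sum>r = s..t. \<xi> (r + int l) * \<theta> l (r + int l) * \<epsilon> r x) (S l) at_bot"
    if "l \<in> {1..q}" for l
    using tendsto_L2_compose[OF S[OF that] filterlim_int_add_at_bot[of "int l"]]
    by (simp add: \<xi>_def sum_principal_det_lag_shift[where \<theta> = "\<theta> l" and u = "\<lambda>r. \<epsilon> r x" for x])
  then have "tendsto_L2 M (\<lambda>s x. (\<Sum>r = s..t. \<xi> r * \<epsilon> r x)
      + (\<Sum>l = 1..q. \<Sum>r = s..t. \<xi> (r + int l) * \<theta> l (r + int l) * \<epsilon> r x)) S\<^sub>q at_bot"
    unfolding S\<^sub>q_def by (intro tendsto_L2_add tendsto_L2_sum S0)
  moreover have "(\<Sum>r = s..t. \<xi> r * \<epsilon> r x)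
      + (\<Sum>l = 1..q. \<Sum>r = s..t. \<xi> (r + int l) * \<theta> l (r + int l) * \<epsilon> r x)
      = (\<Sum>r = s..t. principal_det_ma p q \<phi> \<theta> t r * \<epsilon> r x)" for s x
    by (subst sum.swap)
      (simp add: principal_det_ma_def \<xi>_def distrib_right sum.distrib sum_distrib_right)
  ultimately have 1: "L2_sums_upto M (\<lambda>r x. principal_det_ma p q \<phi> \<theta> t r * \<epsilon> r x) t S\<^sub>q"
    by (simp add: L2_sums_upto_def)
  have "(\<lambda>r. \<xi> r * \<mu> r) summable_on {..t}"
    by (rule abs_summable_summable) (use summable_on_bounded_mult[OF \<xi> \<mu>] in \<open>simp add: \<xi>_def\<close>)
  then have "tendsto_L2 M (\<lambda>s x. \<Sum>r = s..t. \<xi> r * \<mu> r)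
      (\<lambda>x. \<Sum>\<^sub>\<infinity>r\<in>{..t}. \<xi> r * \<mu> r) at_bot"
    by (intro tendsto_L2_of_tendsto tendsto_sum_infsum_int_atMost finite_measure_axioms)
  then have "tendsto_L2 M (\<lambda>s x. (\<Sum>r = s..t. \<xi> r * \<mu> r) + ((\<Sum>r = s..t. \<xi> r * \<epsilon> r x)
      + (\<Sum>l = 1..q. \<Sum>r = s..t. \<xi> r * \<theta> l r * \<epsilon> (r - int l) x)))
      (\<lambda>x. (\<Sum>\<^sub>\<infinity>r\<in>{..t}. \<xi> r * \<mu> r) + S\<^sub>q x) at_bot"
    unfolding S\<^sub>q_def by (intro tendsto_L2_add tendsto_L2_sum S0 S)
  moreover have "(\<Sum>r = s..t. \<xi> r * \<mu> r) + ((\<Sum>r = s..t. \<xi> r * \<epsilon> r x)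
      + (\<Sum>l = 1..q. \<Sum>r = s..t. \<xi> r * \<theta> l r * \<epsilon> (r - int l) x))
      = (\<Sum>r = s..t. \<xi> r * tvarma_innovation q \<mu> \<theta> \<epsilon> r x)" for s x
    by (subst sum.swap)
      (simp add: tvarma_innovation_def distrib_left sum.distrib sum_distrib_left mult.assoc)
  ultimately have 2: "L2_sums_upto M (\<lambda>r x. principal_det p \<phi> t r * tvarma_innovation q \<mu> \<theta> \<epsilon> r x) t
      (\<lambda>x. (\<Sum>\<^sub>\<infinity>r\<in>{..t}. principal_det p \<phi> t r * \<mu> r) + S\<^sub>q x)"
    by (simp add: L2_sums_upto_def \<xi>_def)
  show ?thesis
    using 1 2 by (rule that)
qed

section \<open>Stable solutions as \<open>L2\<close> limits of the forcing sums\<close>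

text \<open>The truncated sums obey the equation exactly once \<open>s \<le> t\<close>. Its right
  side has finitely many terms, so both sides pass to the limit, and uniqueness of limits equates
  them almost surely.\<close>

lemma solves_tvarma_of_L2_sums_upto:
  assumes p: "p \<ge> 1"
    and y: "\<And>t. L2_sums_upto M
      (\<lambda>r x. principal_det p \<phi> t r * tvarma_innovation q \<mu> \<theta> \<epsilon> r x) t (y t)"
    and v: "\<And>r. tvarma_innovation q \<mu> \<theta> \<epsilon> r \<in> L2 M"
  shows "solves_tvarma M p q \<mu> \<phi> \<theta> \<epsilon> y"
  unfolding solves_tvarma_iff
proof
  fix t
  define v where "v = tvarma_innovation q \<mu> \<theta> \<epsilon>"
  define P where "P t s x = (\<Sum>r = s..t. principal_det p \<phi> t r * v r x)" for t s x
  have P: "tendsto_L2 M (P t) (y t) at_bot" for t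
    using y[of t] by (simp add: L2_sums_upto_def P_def[abs_def] v_def)
  have P_L2: "P t s \<in> L2 M" for t s
    using P by (simp add: tendsto_L2_def)
  have lim: "tendsto_L2 M (\<lambda>s x. v t x + (\<Sum>m = 1..p. \<phi> m t * P (t - int m) s x))
      (\<lambda>x. v t x + (\<Sum>m = 1..p. \<phi> m t * y (t - int m) x)) at_bot"
    using v by (intro tendsto_L2_add tendsto_L2_sum tendsto_L2_cmult tendsto_L2_const P)
      (simp add: v_def)
  have ev: "eventually (\<lambda>s. AE x in M.
      P t s x = v t x + (\<Sum>m = 1..p. \<phi> m t * P (t - int m) s x)) at_bot"
    using eventually_le_at_bot[of t]
  proof eventually_elim
    case (elim s)
    then show ?case
      unfolding P_def by (intro AE_I2 particular_solution_rec[OF p])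
  qed
  from lim have L2_lim: "(\<lambda>x. v t x + (\<Sum>m = 1..p. \<phi> m t * y (t - int m) x)) \<in> L2 M"
    by (simp only: tendsto_L2_def)
  have "tendsto_L2 M (P t) (\<lambda>x. v t x + (\<Sum>m = 1..p. \<phi> m t * y (t - int m) x)) at_bot"
    by (rule tendsto_L2_cong_AE[OF lim ev _ P_L2 L2_lim]) simp
  then show "AE x in M. y t x =
      tvarma_innovation q \<mu> \<theta> \<epsilon> t x + (\<Sum>m = 1..p. \<phi> m t * y (t - int m) x)"
    unfolding v_def by (intro tendsto_L2_unique[OF P]) simp_all
qed

text \<open>
  A solution differs from the partial sum of its particular part exactly by the term whose
  decay defines asymptotic stability.
\<close>

lemma asymptotically_stable_iff_L2_sums_upto:
  assumes p: "p \<ge> 1"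
    and y_L2: "\<And>t. y t \<in> L2 M" and y: "solves_tvarma M p q \<mu> \<phi> \<theta> \<epsilon> y"
    and v: "\<And>r. tvarma_innovation q \<mu> \<theta> \<epsilon> r \<in> L2 M"
  shows "asymptotically_stable M p \<phi> y \<longleftrightarrow> (\<forall>t. L2_sums_upto M
      (\<lambda>r x. principal_det p \<phi> t r * tvarma_innovation q \<mu> \<theta> \<epsilon> r x) t (y t))"
proof -
  define P where
    "P t s x = (\<Sum>r = s..t. principal_det p \<phi> t r * tvarma_innovation q \<mu> \<theta> \<epsilon> r x)" for t s x
  define H where
    "H t s x = (\<Sum>m = 1..p. fundamental_sol p \<phi> m t s * y (s + 1 - int m) x)" for t s x
  have P_L2: "P t s \<in> L2 M" for t s
    unfolding P_def[abs_def] by (intro L2_sum L2_cmult v)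
  have H_L2: "H t s \<in> L2 M" for t s
    unfolding H_def[abs_def] by (intro L2_sum L2_cmult y_L2)
  \<comment> \<open>Countably many null sets are merged, so the pathwise lemma can use the equation
    at all times for a single \<open>x\<close>.\<close>
  have "AE x in M. \<forall>t. y t x =
      tvarma_innovation q \<mu> \<theta> \<epsilon> t x + (\<Sum>m = 1..p. \<phi> m t * y (t - int m) x)"
    using y by (simp add: solves_tvarma_iff AE_all_countable)
  then have eq: "AE x in M. y t x = H t s x + P t (s + 1) x" if "s < t" for s t
  proof eventually_elim
    case (elim x)
    then show ?case
      unfolding H_def P_def using elim
      by (intro difference_equation_solution[OF p that, where \<phi> = \<phi>]) blast
  qed
  have "tendsto_L2 M (H t) (\<lambda>x. 0) at_bot \<longleftrightarrow> tendsto_L2 M (P t) (y t) at_bot" for t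
  proof
    assume "tendsto_L2 M (H t) (\<lambda>x. 0) at_bot"
    then have "tendsto_L2 M (\<lambda>s x. y t x - H t s x) (\<lambda>x. y t x - 0) at_bot"
      by (intro tendsto_L2_diff tendsto_L2_const y_L2)
    \<comment> \<open>Initial values at time \<open>s\<close> and earlier go with a forcing sum
      starting at \<open>s + 1\<close>; the shift by one aligns the two.\<close>
    from tendsto_L2_compose[OF this filterlim_int_add_at_bot[of "- 1"]]
    have lim: "tendsto_L2 M (\<lambda>s x. y t x - H t (s - 1) x) (y t) at_bot"
      by simp
    have "eventually (\<lambda>s. AE x in M. P t s x = y t x - H t (s - 1) x) at_bot"
      using eventually_le_at_bot[of t]
    proof eventually_elim
      case (elim s)
      then have "s - 1 < t"
        by simp
      from eq[OF this] show ?case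
        by eventually_elim simp
    qed
    with lim show "tendsto_L2 M (P t) (y t) at_bot"
      by (rule tendsto_L2_cong_AE) (auto simp: P_L2 y_L2)
  next
    assume "tendsto_L2 M (P t) (y t) at_bot"
    then have lim: "tendsto_L2 M (\<lambda>s x. y t x - P t (s + 1) x) (\<lambda>x. y t x - y t x) at_bot"
      by (intro tendsto_L2_diff tendsto_L2_const y_L2 tendsto_L2_compose[OF _ filterlim_int_add_at_bot])
    have "eventually (\<lambda>s. AE x in M. H t s x = y t x - P t (s + 1) x) at_bot"
      using eventually_le_at_bot[of "t - 1"]
    proof eventually_elim
      case (elim s)
      then have "s < t"
        by simp
      from eq[OF this] show ?case
        by eventually_elim simp
    qed
    with lim show "tendsto_L2 M (H t) (\<lambda>x. 0) at_bot"
      by (rule tendsto_L2_cong_AE) (auto simp: H_L2 L2_zero)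
  qed
  then show ?thesis
    by (simp add: asymptotically_stable_def L2_sums_upto_def H_def[abs_def] P_def[abs_def])
qed

theorem theorem4:
  fixes M :: "'a measure" and p q :: nat
    and \<mu> :: "int \<Rightarrow> real" and \<phi> \<theta> :: "nat \<Rightarrow> int \<Rightarrow> real"
    and \<epsilon> :: "int \<Rightarrow> 'a \<Rightarrow> real" and \<sigma> :: "int \<Rightarrow> real" and B :: real
  assumes "prob_space M"
    and "p \<ge> 1" and "q \<ge> 1"
    and "\<And>t. \<epsilon> t \<in> L2 M"
    and "\<And>t. (\<integral>x. \<epsilon> t x \<partial>M) = 0"
    and "\<And>s t. s \<noteq> t \<Longrightarrow> (\<integral>x. \<epsilon> t x * \<epsilon> s x \<partial>M) = 0"
    and "\<And>t. (\<integral>x. (\<epsilon> t x)\<^sup>2 \<partial>M) = (\<sigma> t)\<^sup>2"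
    and "\<And>t. 0 < (\<sigma> t)\<^sup>2" and "\<And>t. (\<sigma> t)\<^sup>2 \<le> B"
    and "\<And>y t. stable_L2_solution M p q \<mu> \<phi> \<theta> \<epsilon> y \<Longrightarrow>
           (AE x in M. real_cond_exp M (past_algebra M y t) (\<epsilon> t) x = 0)"
    and "\<And>t. (\<lambda>r. \<bar>principal_det p \<phi> t r\<bar>) summable_on {..t}"
    and "bounded (range \<mu>)"
    and "\<And>l. 1 \<le> l \<Longrightarrow> l \<le> q \<Longrightarrow> bounded (range (\<theta> l))"
  shows "\<exists>y. stable_L2_solution M p q \<mu> \<phi> \<theta> \<epsilon> y
           \<and> (\<forall>z. stable_L2_solution M p q \<mu> \<phi> \<theta> \<epsilon> z \<longrightarrow> (\<forall>t. AE x in M. z t x = y t x))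
           \<and> (\<forall>t. (\<lambda>r. principal_det p \<phi> t r * \<mu> r) summable_on {..t}
                \<and> (\<exists>S. L2_sums_upto M (\<lambda>r x. principal_det_ma p q \<phi> \<theta> t r * \<epsilon> r x) t S
                     \<and> (AE x in M. y t x =
                           (\<Sum>\<^sub>\<infinity>r\<in>{..t}. principal_det p \<phi> t r * \<mu> r) + S x)))"
proof -
  interpret prob_space M by (rule assms(1))
  note L2_\<epsilon> = assms(4) and \<xi>_summable = assms(11)
  have v: "tvarma_innovation q \<mu> \<theta> \<epsilon> r \<in> L2 M" for r
    by (intro tvarma_innovation_L2 finite_measure_axioms L2_\<epsilon>)
  let ?noise_sum = "\<lambda>t. L2_sums_upto M (\<lambda>r x. principal_det_ma p q \<phi> \<theta> t r * \<epsilon> r x) t"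
  let ?solution_sum =
    "\<lambda>t. L2_sums_upto M (\<lambda>r x. principal_det p \<phi> t r * tvarma_innovation q \<mu> \<theta> \<epsilon> r x) t"
  let ?mean = "\<lambda>t. \<Sum>\<^sub>\<infinity>r\<in>{..t}. principal_det p \<phi> t r * \<mu> r"
  have "\<forall>t. \<exists>S. ?noise_sum t S \<and> ?solution_sum t (\<lambda>x. ?mean t + S x)"
  proof
    fix t
    \<comment> \<open>The uniform variance bound is the constant that controls the \<open>L2\<close>
      series.\<close>
    have "(\<integral>x. (\<epsilon> t x)\<^sup>2 \<partial>M) \<le> B" for t
      using assms(7,9) by simp
    from L2_sums_upto_innovations[of M \<epsilon> B p \<phi> t \<mu> q \<theta>, OF assms(1) L2_\<epsilon> this \<xi>_summable assms(12,13)]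
    show "\<exists>S. ?noise_sum t S \<and> ?solution_sum t (\<lambda>x. ?mean t + S x)"
      by blast
  qed
  from choice[OF this] obtain S where
    S: "\<forall>t. ?noise_sum t (S t) \<and> ?solution_sum t (\<lambda>x. ?mean t + S t x)" ..
  \<comment> \<open>A version of each noise limit has been chosen, so the representation of
    \<open>y\<close> holds pointwise for that choice.\<close>
  define y where "y t x = ?mean t + S t x" for t x
  have y_sums: "?solution_sum t (y t)" for t
    using S by (simp add: y_def[abs_def])
  then have y_L2: "y t \<in> L2 M" for t
    by (simp add: L2_sums_upto_def tendsto_L2_def)
  have y_solves: "solves_tvarma M p q \<mu> \<phi> \<theta> \<epsilon> y"
    by (rule solves_tvarma_of_L2_sums_upto[OF \<open>p \<ge> 1\<close> y_sums v])
  have stable: "stable_L2_solution M p q \<mu> \<phi> \<theta> \<epsilon> y"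
    using y_L2 y_solves y_sums
      asymptotically_stable_iff_L2_sums_upto[OF \<open>p \<ge> 1\<close> y_L2 y_solves v]
    by (simp add: stable_L2_solution_def)
  have unique: "AE x in M. z t x = y t x" if "stable_L2_solution M p q \<mu> \<phi> \<theta> \<epsilon> z" for z t
  proof -
    have z: "\<And>t. z t \<in> L2 M" "solves_tvarma M p q \<mu> \<phi> \<theta> \<epsilon> z" "asymptotically_stable M p \<phi> z"
      using that by (simp_all add: stable_L2_solution_def)
    \<comment> \<open>The forcing sums do not involve the solution, so \<open>z t\<close> and
      \<open>y t\<close> are limits of the same sums.\<close>
    have "?solution_sum t (z t)"
      using asymptotically_stable_iff_L2_sums_upto[OF \<open>p \<ge> 1\<close> z(1,2) v] z(3) by blast
    then show ?thesis
      using y_sums[of t] unfolding L2_sums_upto_def by (rule tendsto_L2_unique) simp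
  qed
  have "(\<lambda>r. principal_det p \<phi> t r * \<mu> r) summable_on {..t}" for t
    by (rule abs_summable_summable)
      (use summable_on_bounded_mult[OF \<xi>_summable assms(12)] in simp)
  moreover have "\<exists>S. ?noise_sum t S \<and> (AE x in M. y t x = ?mean t + S x)" for t
    using S by (intro exI[of _ "S t"]) (simp add: y_def)
  ultimately show ?thesis
    using stable unique by (intro exI[of _ y] conjI allI impI) assumption+
qed

end
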